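(* Let $E$ be a complex Banach space, let $I=\mathbb{R}$ or $I=[0,\infty)$, let $k\in\mathbb{R}$ and let $f\in C_b(I:E)$. Then the following holds: (i) $f$ is semi-Bloch $k$-periodic if and only if the function $x\mapsto e^{-ikx}f(x)$, $x\in I$, is semi-periodic. (ii) $f$ is semi-Bloch $k$-periodic if and only if there exists a sequence $(f_n)$ in $P_c(I:E)$ such that $\lim_{n\to\infty}e^{ikx}f_n(x)=f(x)$ uniformly in $x\in I$. (iii) $f$ is semi-Bloch $k$-periodic if and only if there exists a sequence $(f_n)$ in $\mathcal{B}_k(I:E)$ such that $\lim_{n\to\infty}f_n(x)=f(x)$ uniformly in $x\in I$.
   Context: $C_b(I:E)$ is the space of bounded continuous functions $I\to E$ with the sup-norm. $P_c(I:E)$ is the set of all continuous periodic functions $f:I\to E$, i.e. continuous functions for which there is some $p>0$ with $f(x+p)=f(x)$ for all $x\in I$ (the period may depend on $f$). Set $\mathbb{S}:=\mathbb{N}$ if $I=[0,\infty)$ and $\mathbb{S}:=\mathbb{Z}$ if $I=\mathbb{R}$. For $p>0$ and $k\in\mathbb{R}$, a bounded continuous function $f:I\to E$ is Bloch $(p,k)$-periodic if $f(x+p)=e^{ikp}f(x)$ for all $x\in I$; the set of all such functions is $\mathcal{B}_{p,k}(I:E)$, and $\mathcal{B}_k(I:E):=\bigcup_{p>0}\mathcal{B}_{p,k}(I:E)$. A function $f\in C_b(I:E)$ is semi-Bloch $k$-periodic if for every $\varepsilon>0$ there exists $p>0$ such that for all $m\in\mathbb{S}$ and all $x\in I$ one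 has $\|f(x+mp)-e^{ikmp}f(x)\|\le\varepsilon$. A function is semi-periodic if it is semi-Bloch $0$-periodic. *)

theory Defs
  imports "HOL-Analysis.Analysis"
begin

text \<open>Complex Banach spaces: a complex scalar multiplication on a real Banach space, extending
  the real one and for which the norm is homogeneous.\<close>

class complex_banach = banach +
  fixes scaleC :: "complex \<Rightarrow> 'a \<Rightarrow> 'a"  (infixr \<open>*\<^sub>C\<close> 75)
  assumes scaleC_add_right: "a *\<^sub>C (x + y) = a *\<^sub>C x + a *\<^sub>C y"
    and scaleC_add_left: "(a + b) *\<^sub>C x = a *\<^sub>C x + b *\<^sub>C x"
    and scaleC_scaleC: "a *\<^sub>C b *\<^sub>C x = (a * b) *\<^sub>C x"
    and scaleC_of_real: "complex_of_real r *\<^sub>C x = r *\<^sub>R x"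
    and norm_scaleC: "norm (a *\<^sub>C x) = cmod a * norm x"

instantiation complex :: complex_banach
begin

definition scaleC_complex :: "complex \<Rightarrow> complex \<Rightarrow> complex"
  where "scaleC_complex a x = a * x"

instance
  by standard (simp_all add: scaleC_complex_def algebra_simps norm_mult scaleR_conv_of_real)

end

text \<open>A function \<open>I \<rightarrow> E\<close> is represented by a total function on the reals of which only the
  values on \<open>I\<close> matter; \<open>I\<close> is always \<open>UNIV\<close> or \<open>{0..}\<close>.\<close>

definition C_b :: "real set \<Rightarrow> (real \<Rightarrow> 'a::complex_banach) set"
  where "C_b I = {f. continuous_on I f \<and> bounded (f ` I)}"

definition P_c :: "real set \<Rightarrow> (real \<Rightarrow> 'a::complex_banach) set"
  where "P_c I = {f. continuous_on I f \<and> (\<exists>p>0. \<forall>x\<in>I. f (x + p) = f x)}"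

definition shifts :: "real set \<Rightarrow> real set"
  where "shifts I = (if I = {0..} then \<nat> else \<int>)"

definition bloch_pk :: "real \<Rightarrow> real \<Rightarrow> real set \<Rightarrow> (real \<Rightarrow> 'a::complex_banach) set"
  where "bloch_pk p k I =
    {f \<in> C_b I. \<forall>x\<in>I. f (x + p) = exp (\<i> * complex_of_real (k * p)) *\<^sub>C f x}"

definition bloch :: "real \<Rightarrow> real set \<Rightarrow> (real \<Rightarrow> 'a::complex_banach) set"
  where "bloch k I = (\<Union>p\<in>{0<..}. bloch_pk p k I)"

definition semi_bloch :: "real \<Rightarrow> real set \<Rightarrow> (real \<Rightarrow> 'a::complex_banach) \<Rightarrow> bool"
  where "semi_bloch k I f \<longleftrightarrow> f \<in> C_b I \<and>
    (\<forall>\<epsilon>>0. \<exists>p>0. \<forall>m\<in>shifts I. \<forall>x\<in>I.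
      norm (f (x + m * p) - exp (\<i> * complex_of_real (k * m * p)) *\<^sub>C f x) \<le> \<epsilon>)"

definition semi_periodic :: "real set \<Rightarrow> (real \<Rightarrow> 'a::complex_banach) \<Rightarrow> bool"
  where "semi_periodic I f \<longleftrightarrow> semi_bloch 0 I f"

end

theory Submission
  imports Defs
begin

text \<open>The map \<open>f \<mapsto> e\<^bsup>-ikx\<^esup> f(x)\<close> is an isometric bijection for the sup-norm, and since
  \<open>e\<^bsup>-iky\<^esup> f(y) - e\<^bsup>-ikx\<^esup> f(x) = e\<^bsup>-iky\<^esup> (f(y) - e\<^bsup>ik(y-x)\<^esup> f(x))\<close> it turns Bloch conditions
  into the corresponding periodicity conditions with the same \<open>p\<close> and the same error
  (\<open>norm_twist_diff\<close>). This is part (i), and it reduces (ii) and (iii) to the case \<open>k = 0\<close>: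
  a function is semi-periodic iff it is a uniform limit of continuous periodic functions
  (\<open>semi_periodic_iff_uniform_limit\<close>).

  That a uniform limit of periodic functions is semi-periodic is an \<open>\<epsilon>/2\<close> argument. Conversely, let
  all shifts of \<open>g\<close> by multiples of \<open>p\<close> be \<open>\<epsilon>\<close>-close to \<open>g\<close>. Then \<open>g\<close> is \<open>\<epsilon>\<close>-close to the
  periodic continuation of its restriction to \<open>[0,p)\<close>. This continuation may jump at the
  multiples of \<open>p\<close>, but only by \<open>g(0) - g(p)\<close>, which has norm at most \<open>\<epsilon>\<close>; adding the linear
  function \<open>x \<mapsto> (x/p)(g(0) - g(p))\<close> on \<open>[0,p]\<close> before continuing makes the result continuous
  and costs another \<open>\<epsilon>\<close> (\<open>periodic_approximation\<close>).\<close>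

section \<open>Complex scalar multiplication\<close>

lemma bounded_bilinear_scaleC:
  "bounded_bilinear (scaleC :: complex \<Rightarrow> 'a::complex_banach \<Rightarrow> 'a)"
proof
  fix a b :: complex and x y :: 'a and r :: real
  show "(a + b) *\<^sub>C x = a *\<^sub>C x + b *\<^sub>C x" by (rule scaleC_add_left)
  show "a *\<^sub>C (x + y) = a *\<^sub>C x + a *\<^sub>C y" by (rule scaleC_add_right)
  show "(r *\<^sub>R a) *\<^sub>C x = r *\<^sub>R (a *\<^sub>C x)"
    by (metis scaleC_of_real scaleC_scaleC scaleR_conv_of_real)
  show "a *\<^sub>C (r *\<^sub>R x) = r *\<^sub>R (a *\<^sub>C x)"
    by (metis scaleC_of_real scaleC_scaleC mult.commute)
  show "\<exists>K. \<forall>(a::complex) (x::'a). norm (a *\<^sub>C x) \<le> norm a * norm x * K"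
    by (intro exI[of _ 1]) (simp add: norm_scaleC)
qed

lemmas scaleC_diff_right = bounded_bilinear.diff_right[OF bounded_bilinear_scaleC]

lemma scaleC_one: "1 *\<^sub>C x = (x :: 'a::complex_banach)"
  using scaleC_of_real[of 1 x] by simp

section \<open>Multiplication by a character\<close>

definition twist :: "real \<Rightarrow> (real \<Rightarrow> 'a::complex_banach) \<Rightarrow> real \<Rightarrow> 'a"
  where "twist k f = (\<lambda>x. exp (\<i> * complex_of_real (k * x)) *\<^sub>C f x)"

lemma norm_twist [simp]: "norm (twist k f x) = norm (f x)"
  by (simp add: twist_def norm_scaleC)

lemma twist_twist_uminus [simp]:
  "twist k (twist (-k) f) = f" "twist (-k) (twist k f) = f"
  by (simp_all add: twist_def scaleC_scaleC flip: exp_add) (simp_all add: scaleC_one)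

lemma norm_twist_minus_twist: "norm (twist k f x - twist k g x) = norm (f x - g x)"
  by (simp add: twist_def norm_scaleC flip: scaleC_diff_right)

text \<open>Pulling out the unimodular factor \<open>e\<^bsup>-iky\<^esup>\<close> turns an increment of the twisted function into
  a Bloch increment of the function itself.\<close>

lemma norm_twist_diff:
  "norm (twist (-k) f y - twist (-k) f x)
    = norm (f y - exp (\<i> * complex_of_real (k * (y - x))) *\<^sub>C f x)"
proof -
  have "exp (\<i> * complex_of_real (-k * x))
      = exp (\<i> * complex_of_real (-k * y)) * exp (\<i> * complex_of_real (k * (y - x)))"
    by (simp add: algebra_simps flip: exp_add)
  then have "twist (-k) f y - twist (-k) f x
      = exp (\<i> * complex_of_real (-k * y)) *\<^sub>C
          (f y - exp (\<i> * complex_of_real (k * (y - x))) *\<^sub>C f x)"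
    unfolding twist_def by (simp only: scaleC_diff_right scaleC_scaleC)
  then show ?thesis by (simp add: norm_scaleC)
qed

lemma continuous_on_twist: "continuous_on I f \<Longrightarrow> continuous_on I (twist k f)"
  unfolding twist_def
  by (intro bounded_bilinear.continuous_on[OF bounded_bilinear_scaleC] continuous_intros)

lemma continuous_on_twist_iff: "continuous_on I (twist k f) \<longleftrightarrow> continuous_on I f"
  using continuous_on_twist[of I f k] continuous_on_twist[of I "twist k f" "-k"] by auto

lemma twist_in_C_b_iff: "twist k f \<in> C_b I \<longleftrightarrow> f \<in> C_b I"
  by (simp add: C_b_def continuous_on_twist_iff bounded_iff)

lemma uniform_limit_twist_iff:
  "uniform_limit I (\<lambda>n. twist k (F n)) (twist k f) A \<longleftrightarrow> uniform_limit I F f A"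
  by (simp add: uniform_limit_iff dist_norm norm_twist_minus_twist)

lemma semi_bloch_iff_semi_periodic_twist:
  "semi_bloch k I f \<longleftrightarrow> semi_periodic I (twist (-k) f)"
proof -
  have "norm (f (x + m * p) - exp (\<i> * complex_of_real (k * m * p)) *\<^sub>C f x)
      = norm (twist (-k) f (x + m * p) - exp (\<i> * complex_of_real (0 * m * p)) *\<^sub>C twist (-k) f x)"
    for x m p
    by (simp add: norm_twist_diff scaleC_one mult.assoc)
  then show ?thesis
    by (simp only: semi_periodic_def semi_bloch_def twist_in_C_b_iff)
qed

section \<open>Continuous periodic functions\<close>

lemma shift_in_domain:
  assumes "I = UNIV \<or> I = {0..}" and "m \<in> shifts I" and "x \<in> I" and "0 < p"
  shows "x + m * p \<in> I"
  using assms by (auto simp: shifts_def elim!: Nats_cases)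

lemma periodic_shift:
  assumes I: "I = UNIV \<or> I = {0..}" and p: "0 < p"
    and F: "\<And>x. x \<in> I \<Longrightarrow> F (x + p) = F x"
    and m: "m \<in> shifts I" and x: "x \<in> I"
  shows "F (x + m * p) = F x"
proof -
  have *: "F (y + of_nat n * p) = F y" if "y \<in> I" for y n
  proof (induction n)
    case (Suc n)
    have "y + of_nat n * p \<in> I" using I p that by auto
    from F[OF this] show ?case using Suc by (simp add: algebra_simps)
  qed simp
  show ?thesis
  proof (cases "m \<ge> 0")
    case True
    then obtain n where "m = of_nat n"
      using m by (metis Ints_cases Nats_cases of_int_0_le_iff of_int_of_nat_eq shifts_def
          zero_le_imp_eq_int)
    then show ?thesis using *[OF x] by simp
  next
    \<comment> \<open>Negative shifts occur only on the whole line; then \<open>x\<close> is a positive shift of \<open>x + mp\<close>.\<close>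
    case False
    then have "I = UNIV" and "m \<in> \<int>"
      using I m by (auto simp: shifts_def elim!: Nats_cases split: if_splits)
    then obtain n where "m = - of_nat n"
      using False by (metis Ints_cases minus_minus nle_le of_int_0_le_iff of_int_minus
          of_int_of_nat_eq neg_0_le_iff_le zero_le_imp_eq_int)
    then show ?thesis using *[of "x + m * p" n] \<open>I = UNIV\<close> by simp
  qed
qed

text \<open>The decomposition of a point of \<open>I\<close> into a multiple of \<open>p\<close> and a remainder in \<open>[0,p)\<close>
  uses only multiples from the shift set: on the half-line the quotient is nonnegative.\<close>

lemma floor_in_shifts:
  assumes "I = UNIV \<or> I = {0..}" and "x \<in> I" and "0 < p"
  shows "of_int \<lfloor>x / p\<rfloor> \<in> shifts I"
proof (cases "I = {0..}")
  case True
  then have "\<lfloor>x / p\<rfloor> \<ge> 0" using assms by simp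
  then obtain n where "\<lfloor>x / p\<rfloor> = int n" by (metis zero_le_imp_eq_int)
  then show ?thesis using True by (simp add: shifts_def)
qed (simp add: shifts_def)

lemma frac_decomposition:
  fixes x p :: real
  assumes "0 < p"
  shows "x = p * frac (x / p) + of_int \<lfloor>x / p\<rfloor> * p"
  using assms by (simp add: frac_def algebra_simps)

lemma scaled_frac_in_interval:
  fixes x p :: real
  assumes "0 < p"
  shows "p * frac (x / p) \<in> {0..p}"
  using assms frac_lt_1[of "x / p"] by (simp add: mult_le_cancel_left1)

text \<open>Boundedness is part of being Bloch periodic but not of being a member of \<open>P_c\<close>. There it
  follows from compactness of one period, which makes the approximants of (ii) and (iii)
  correspond to each other under twisting.\<close>

lemma bounded_P_c:
  assumes I: "I = UNIV \<or> I = {0..}" and F: "F \<in> P_c I"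
  shows "bounded (F ` I)"
proof -
  from F obtain p where p: "0 < p" and per: "\<And>x. x \<in> I \<Longrightarrow> F (x + p) = F x"
    and cont: "continuous_on I F"
    by (auto simp: P_c_def)
  have sub: "{0..p} \<subseteq> I" using I by auto
  have "F ` I \<subseteq> F ` {0..p}"
  proof (rule image_subsetI)
    fix x assume x: "x \<in> I"
    have "p * frac (x / p) \<in> I" using scaled_frac_in_interval[OF p] sub by blast
    then have "F (p * frac (x / p) + of_int \<lfloor>x / p\<rfloor> * p) = F (p * frac (x / p))"
      by (intro periodic_shift[OF I p] per floor_in_shifts[OF I x p])
    then have "F x = F (p * frac (x / p))" using frac_decomposition[OF p, of x] by simp
    then show "F x \<in> F ` {0..p}" using scaled_frac_in_interval[OF p] by blast
  qed
  moreover have "bounded (F ` {0..p})"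
    by (intro compact_imp_bounded compact_continuous_image continuous_on_subset[OF cont sub])
      simp
  ultimately show ?thesis by (rule bounded_subset[rotated])
qed

lemma bloch_iff_P_c_twist:
  assumes I: "I = UNIV \<or> I = {0..}"
  shows "F \<in> bloch k I \<longleftrightarrow> twist (-k) F \<in> P_c I"
proof -
  have eq: "twist (-k) F (x + p) = twist (-k) F x \<longleftrightarrow>
      F (x + p) = exp (\<i> * complex_of_real (k * p)) *\<^sub>C F x" for x p
    using norm_twist_diff[of k F "x + p" x] by (metis add_diff_cancel_left' norm_eq_zero
        right_minus_eq)
  have "bounded (F ` I)" if "twist (-k) F \<in> P_c I"
    using bounded_P_c[OF I that] by (simp add: bounded_iff)
  then show ?thesis
    by (auto simp: bloch_def bloch_pk_def P_c_def C_b_def continuous_on_twist_iff eq)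
qed

section \<open>Periodic continuation\<close>

text \<open>A function on \<open>[0,1]\<close> with equal boundary values descends to the circle. Every point lies
  in the interior of an interval \<open>[n-1,n+1]\<close>, on which the continuation is glued from two
  translates of the given function that agree at \<open>n\<close>.\<close>

lemma continuous_on_frac_compose:
  fixes \<phi> :: "real \<Rightarrow> 'b::topological_space"
  assumes cont: "continuous_on {0..1} \<phi>" and ends: "\<phi> 0 = \<phi> 1"
  shows "continuous_on UNIV (\<lambda>x. \<phi> (frac x))"
proof -
  have piece: "continuous_on {of_int n..of_int n + 1} (\<lambda>x. \<phi> (frac x))" for n :: int
  proof -
    have "continuous_on {of_int n..of_int n + 1} (\<lambda>x::real. \<phi> (x - of_int n))"
      by (rule continuous_on_compose2[OF cont]) (auto intro!: continuous_intros)
    moreover have "\<phi> (x - of_int n) = \<phi> (frac x)" if "x \<in> {of_int n..of_int n + 1}" for x :: real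
    proof (cases "x = of_int n + 1")
      case True
      then show ?thesis using ends by (simp add: frac_def)
    next
      case False
      then have "\<lfloor>x\<rfloor> = n" using that by (intro floor_unique) auto
      then show ?thesis by (simp add: frac_def)
    qed
    ultimately show ?thesis by (rule continuous_on_eq)
  qed
  have "isCont (\<lambda>x. \<phi> (frac x)) x" for x :: real
  proof -
    define n where "n = \<lfloor>x\<rfloor>"
    have "continuous_on ({of_int (n - 1)..of_int (n - 1) + 1} \<union> {of_int n..of_int n + 1})
        (\<lambda>x::real. \<phi> (frac x))"
      by (intro continuous_on_closed_Un piece) auto
    then have "continuous_on {of_int n - 1<..<of_int n + 1} (\<lambda>x::real. \<phi> (frac x))"
      by (rule continuous_on_subset) auto
    moreover have "x \<in> {of_int n - 1<..<of_int n + 1}"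
      unfolding n_def using floor_correct[of x] by simp linarith
    ultimately show ?thesis
      by (simp add: continuous_on_eq_continuous_at)
  qed
  then show ?thesis by (simp add: continuous_at_imp_continuous_on)
qed

lemma periodic_approximation:
  fixes g :: "real \<Rightarrow> 'a::complex_banach"
  assumes I: "I = UNIV \<or> I = {0..}" and cont: "continuous_on I g" and p: "0 < p"
    and close: "\<And>m x. m \<in> shifts I \<Longrightarrow> x \<in> I \<Longrightarrow> norm (g (x + m * p) - g x) \<le> \<epsilon>"
  obtains h where "h \<in> P_c I" and "\<And>x. x \<in> I \<Longrightarrow> norm (h x - g x) \<le> 2 * \<epsilon>"
proof
  define \<phi> where "\<phi> t = g (p * t) + t *\<^sub>R (g 0 - g p)" for t
  define h where "h x = \<phi> (frac (x / p))" for x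
  have sub: "{0..p} \<subseteq> I" using I by auto
  have jump: "norm (g 0 - g p) \<le> \<epsilon>"
    using close[of 1 0] I by (auto simp: shifts_def norm_minus_commute)
  have "continuous_on {0..1} (\<lambda>t. g (p * t))"
    using p sub by (intro continuous_on_compose2[OF cont] continuous_intros)
      (auto simp: mult_le_cancel_left1)
  then have "continuous_on {0..1} \<phi>"
    unfolding \<phi>_def by (intro continuous_intros)
  then have "continuous_on UNIV (\<lambda>x. \<phi> (frac x))"
    by (rule continuous_on_frac_compose) (simp add: \<phi>_def)
  then have "continuous_on I h"
    unfolding h_def by (rule continuous_on_compose2) (use p in \<open>auto intro!: continuous_intros\<close>)
  moreover have "h (x + p) = h x" for x
    using p by (simp add: h_def add_divide_distrib frac_def)
  ultimately show "h \<in> P_c I" using p by (auto simp: P_c_def)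
  fix x assume x: "x \<in> I"
  define y where "y = p * frac (x / p)"
  have y: "y \<in> I" using scaled_frac_in_interval[OF p] sub by (auto simp: y_def)
  have "h x - g x = frac (x / p) *\<^sub>R (g 0 - g p) - (g (y + of_int \<lfloor>x / p\<rfloor> * p) - g y)"
    using frac_decomposition[OF p, of x] by (simp add: h_def \<phi>_def y_def)
  also have "norm \<dots> \<le> norm (frac (x / p) *\<^sub>R (g 0 - g p))
      + norm (g (y + of_int \<lfloor>x / p\<rfloor> * p) - g y)"
    by (rule norm_triangle_ineq4)
  also have "norm (frac (x / p) *\<^sub>R (g 0 - g p)) \<le> 1 * \<epsilon>"
    unfolding norm_scaleR using jump frac_lt_1[of "x / p"] by (intro mult_mono) auto
  also have "norm (g (y + of_int \<lfloor>x / p\<rfloor> * p) - g y) \<le> \<epsilon>"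
    by (rule close[OF floor_in_shifts[OF I x p] y])
  finally show "norm (h x - g x) \<le> 2 * \<epsilon>" by simp
qed

section \<open>Semi-periodic functions as uniform limits\<close>

lemma semi_periodic_iff:
  "semi_periodic I g \<longleftrightarrow> g \<in> C_b I \<and>
    (\<forall>\<epsilon>>0. \<exists>p>0. \<forall>m\<in>shifts I. \<forall>x\<in>I. norm (g (x + m * p) - g x) \<le> \<epsilon>)"
  by (simp add: semi_periodic_def semi_bloch_def scaleC_one)

lemma semi_periodic_iff_uniform_limit:
  fixes g :: "real \<Rightarrow> 'a::complex_banach"
  assumes I: "I = UNIV \<or> I = {0..}" and g: "g \<in> C_b I"
  shows "semi_periodic I g \<longleftrightarrow>
    (\<exists>F :: nat \<Rightarrow> real \<Rightarrow> 'a. (\<forall>n. F n \<in> P_c I) \<and> uniform_limit I F g sequentially)"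
proof
  assume semi: "semi_periodic I g"
  have "\<exists>h. h \<in> P_c I \<and> (\<forall>x\<in>I. norm (h x - g x) \<le> 2 * (1 / Suc n))" for n
  proof -
    obtain p where p: "0 < p"
      and close: "\<And>m x. m \<in> shifts I \<Longrightarrow> x \<in> I \<Longrightarrow> norm (g (x + m * p) - g x) \<le> 1 / Suc n"
      using semi unfolding semi_periodic_iff by (metis of_nat_0_less_iff zero_less_Suc
          zero_less_divide_1_iff)
    have "continuous_on I g" using g by (simp add: C_b_def)
    from periodic_approximation[OF I this p close]
    obtain h where "h \<in> P_c I" "\<And>x. x \<in> I \<Longrightarrow> norm (h x - g x) \<le> 2 * (1 / Suc n)"
      by blast
    then show ?thesis by blast
  qed
  then obtain F where F: "\<And>n. F n \<in> P_c I"
    "\<And>n x. x \<in> I \<Longrightarrow> norm (F n x - g x) \<le> 2 * (1 / Suc n)"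
    by metis
  have "(\<lambda>n. 2 * (1 / real (Suc n))) \<longlonglongrightarrow> 2 * 0"
    by (intro tendsto_mult tendsto_const LIMSEQ_Suc[OF lim_1_over_n])
  then have lim: "(\<lambda>n. 2 * (1 / real (Suc n))) \<longlonglongrightarrow> 0" by simp
  have "uniform_limit I F g sequentially"
  proof (rule uniform_limitI)
    fix e :: real assume "e > 0"
    from order_tendstoD(2)[OF lim this]
    show "\<forall>\<^sub>F n in sequentially. \<forall>x\<in>I. dist (F n x) (g x) < e"
      by eventually_elim (auto simp: dist_norm intro: le_less_trans[OF F(2)])
  qed
  with F(1) show "\<exists>F. (\<forall>n. F n \<in> P_c I) \<and> uniform_limit I F g sequentially" by blast
next
  assume "\<exists>F. (\<forall>n::nat. F n \<in> P_c I) \<and> uniform_limit I F g sequentially"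
  then obtain F :: "nat \<Rightarrow> real \<Rightarrow> 'a" where F: "\<And>n. F n \<in> P_c I"
    and lim: "uniform_limit I F g sequentially" by blast
  have "\<exists>p>0. \<forall>m\<in>shifts I. \<forall>x\<in>I. norm (g (x + m * p) - g x) \<le> \<epsilon>" if "\<epsilon> > 0" for \<epsilon>
  proof -
    obtain n where n: "\<And>x. x \<in> I \<Longrightarrow> dist (F n x) (g x) < \<epsilon> / 2"
      using uniform_limitD[OF lim, of "\<epsilon> / 2"] \<open>\<epsilon> > 0\<close>
      by (auto dest!: eventually_happens)
    obtain p where p: "0 < p" and per: "\<And>x. x \<in> I \<Longrightarrow> F n (x + p) = F n x"
      using F[of n] by (auto simp: P_c_def)
    have "norm (g (x + m * p) - g x) \<le> \<epsilon>" if "m \<in> shifts I" "x \<in> I" for m x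
    proof -
      have "F n (x + m * p) = F n x"
        by (intro periodic_shift[OF I p] per that)
      then have "dist (F n x) (g (x + m * p)) < \<epsilon> / 2"
        using n[OF shift_in_domain[OF I that p]] by simp
      then show ?thesis
        using n[OF that(2)] dist_triangle3[of "g (x + m * p)" "g x" "F n x"]
        by (simp add: dist_norm[symmetric])
    qed
    then show ?thesis using p by blast
  qed
  then show "semi_periodic I g" using g by (simp add: semi_periodic_iff)
qed

theorem proposition2p3:
  fixes I :: "real set" and k :: real and f :: "real \<Rightarrow> 'a::complex_banach"
  assumes "I = UNIV \<or> I = {0..}"
    and "f \<in> C_b I"
  shows "(semi_bloch k I f \<longleftrightarrow>
           semi_periodic I (\<lambda>x. exp (- (\<i> * complex_of_real (k * x))) *\<^sub>C f x)) \<and>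
         (semi_bloch k I f \<longleftrightarrow>
           (\<exists>F :: nat \<Rightarrow> real \<Rightarrow> 'a. (\<forall>n. F n \<in> P_c I) \<and>
             uniform_limit I (\<lambda>n x. exp (\<i> * complex_of_real (k * x)) *\<^sub>C F n x) f sequentially)) \<and>
         (semi_bloch k I f \<longleftrightarrow>
           (\<exists>F :: nat \<Rightarrow> real \<Rightarrow> 'a. (\<forall>n. F n \<in> bloch k I) \<and>
             uniform_limit I F f sequentially))"
proof -
  have twist_minus: "(\<lambda>x. exp (- (\<i> * complex_of_real (k * x))) *\<^sub>C f x) = twist (-k) f"
    by (simp add: twist_def)
  have twist_plus: "(\<lambda>n x. exp (\<i> * complex_of_real (k * x)) *\<^sub>C F n x) = (\<lambda>n. twist k (F n))"
    for F :: "nat \<Rightarrow> real \<Rightarrow> 'a"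
    by (simp add: twist_def)
  have lim: "uniform_limit I F (twist (-k) f) sequentially \<longleftrightarrow>
      uniform_limit I (\<lambda>n. twist k (F n)) f sequentially" for F :: "nat \<Rightarrow> real \<Rightarrow> 'a"
    using uniform_limit_twist_iff[where k = k and F = F and f = "twist (-k) f"] by simp
  have ii: "semi_bloch k I f \<longleftrightarrow> (\<exists>F :: nat \<Rightarrow> real \<Rightarrow> 'a. (\<forall>n. F n \<in> P_c I) \<and>
      uniform_limit I (\<lambda>n. twist k (F n)) f sequentially)"
    using semi_periodic_iff_uniform_limit[OF assms(1), of "twist (-k) f"] assms(2)
    by (simp add: semi_bloch_iff_semi_periodic_twist twist_in_C_b_iff lim)
  have "(\<exists>F :: nat \<Rightarrow> real \<Rightarrow> 'a. (\<forall>n. F n \<in> P_c I) \<and>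
      uniform_limit I (\<lambda>n. twist k (F n)) f sequentially) \<longleftrightarrow>
    (\<exists>F :: nat \<Rightarrow> real \<Rightarrow> 'a. (\<forall>n. F n \<in> bloch k I) \<and> uniform_limit I F f sequentially)"
    (is "?P \<longleftrightarrow> ?B")
  proof
    assume ?P
    then obtain F :: "nat \<Rightarrow> real \<Rightarrow> 'a" where "\<forall>n. F n \<in> P_c I"
      "uniform_limit I (\<lambda>n. twist k (F n)) f sequentially" by blast
    then show ?B
      by (intro exI[of _ "\<lambda>n. twist k (F n)"]) (simp add: bloch_iff_P_c_twist[OF assms(1)])
  next
    assume ?B
    then obtain F :: "nat \<Rightarrow> real \<Rightarrow> 'a" where "\<forall>n. F n \<in> bloch k I"
      "uniform_limit I F f sequentially" by blast
    then show ?P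
      by (intro exI[of _ "\<lambda>n. twist (-k) (F n)"]) (simp add: bloch_iff_P_c_twist[OF assms(1)])
  qed
  with ii show ?thesis
    unfolding twist_minus twist_plus using semi_bloch_iff_semi_periodic_twist by blast
qed

end
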